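(* Let $X$ be a connected graph without loops and multiple edges. The topological space $(VX\cup\Omega_{\mathrm{E}}X,\tau_{\mathrm{E}}X)$ is compact.
   Context: For $e\subseteq VX$ write $e^{*}=VX\setminus e$. The edge-boundary $\delta e$ is the set of edges joining a vertex of $e$ to a vertex of $e^{*}$. An edge-cut is a nonempty set $e\subseteq VX$ with $\delta e$ finite. A ray is a sequence $(x_n)_{n\in\mathbb N}$ of pairwise distinct vertices with $x_n$ adjacent to $x_{n+1}$ for all $n$. A ray lies in $e$ if all but finitely many of its vertices belong to $e$. Two rays are separated by $e$ if one lies in $e$ and the other in $e^{*}$. Two rays are edge-equivalent if no edge-cut separates them; the equivalence classes are the edge-ends of $X$. An edge-end lies in $e$ if all its rays lie in $e$; $\Omega_{\mathrm{E}}e$ is the set of edge-ends lying in $e$, and $\Omega_{\mathrm{E}}X=\Omega_{\mathrm{E}}VX$. The edge-topology $\tau_{\mathrm{E}}X$ on $VX\cup\Omega_{\mathrm{E}}X$ is the topology generated by the base $B_{\mathrm{E}}X=\{e\cup\Omega_{\mathrm{E}}e\mid e\subseteq VX,\ |\delta e|<\infty\}$. *)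

theory Defs
  imports "HOL-Analysis.Analysis"
begin

text \<open>
  A graph is given by its vertex set \<open>V\<close> and its edge set \<open>E\<close>. Edges are two-element sets of
  vertices, so there are neither loops nor multiple edges. No finiteness is assumed.
\<close>

definition simple_graph :: "'a set \<Rightarrow> 'a set set \<Rightarrow> bool" where
  "simple_graph V E \<longleftrightarrow> (\<forall>d\<in>E. \<exists>x\<in>V. \<exists>y\<in>V. x \<noteq> y \<and> d = {x, y})"

definition connected_graph :: "'a set \<Rightarrow> 'a set set \<Rightarrow> bool" where
  "connected_graph V E \<longleftrightarrow> (\<forall>x\<in>V. \<forall>y\<in>V. (x, y) \<in> {(u, v). {u, v} \<in> E}\<^sup>*)"

definition edge_boundary :: "'a set \<Rightarrow> 'a set set \<Rightarrow> 'a set \<Rightarrow> 'a set set" where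
  "edge_boundary V E e = {d \<in> E. \<exists>x\<in>e. \<exists>y\<in>V - e. d = {x, y}}"

definition edge_cut :: "'a set \<Rightarrow> 'a set set \<Rightarrow> 'a set \<Rightarrow> bool" where
  "edge_cut V E e \<longleftrightarrow> e \<subseteq> V \<and> e \<noteq> {} \<and> finite (edge_boundary V E e)"

definition rays :: "'a set \<Rightarrow> 'a set set \<Rightarrow> (nat \<Rightarrow> 'a) set" where
  "rays V E = {x. range x \<subseteq> V \<and> inj x \<and> (\<forall>n. {x n, x (Suc n)} \<in> E)}"

definition ray_lies_in :: "(nat \<Rightarrow> 'a) \<Rightarrow> 'a set \<Rightarrow> bool" where
  "ray_lies_in x e \<longleftrightarrow> finite (range x - e)"

definition separates :: "'a set \<Rightarrow> 'a set \<Rightarrow> (nat \<Rightarrow> 'a) \<Rightarrow> (nat \<Rightarrow> 'a) \<Rightarrow> bool" where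
  "separates V e x y \<longleftrightarrow>
     ray_lies_in x e \<and> ray_lies_in y (V - e) \<or> ray_lies_in y e \<and> ray_lies_in x (V - e)"

definition edge_equivalence :: "'a set \<Rightarrow> 'a set set \<Rightarrow> ((nat \<Rightarrow> 'a) \<times> (nat \<Rightarrow> 'a)) set" where
  "edge_equivalence V E =
     {(x, y). x \<in> rays V E \<and> y \<in> rays V E \<and> \<not> (\<exists>e. edge_cut V E e \<and> separates V e x y)}"

definition edge_ends :: "'a set \<Rightarrow> 'a set set \<Rightarrow> (nat \<Rightarrow> 'a) set set" where
  "edge_ends V E = rays V E // edge_equivalence V E"

definition edge_ends_in :: "'a set \<Rightarrow> 'a set set \<Rightarrow> 'a set \<Rightarrow> (nat \<Rightarrow> 'a) set set" where
  "edge_ends_in V E e = {\<omega> \<in> edge_ends V E. \<forall>x\<in>\<omega>. ray_lies_in x e}"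

text \<open>
  The disjoint union of the vertices and the edge-ends is taken in a sum type:
  \<open>Inl\<close> marks vertices and \<open>Inr\<close> marks edge-ends.
\<close>

definition edge_base :: "'a set \<Rightarrow> 'a set set \<Rightarrow> ('a + (nat \<Rightarrow> 'a) set) set set" where
  "edge_base V E =
     {Inl ` e \<union> Inr ` edge_ends_in V E e | e. e \<subseteq> V \<and> finite (edge_boundary V E e)}"

definition edge_topology :: "'a set \<Rightarrow> 'a set set \<Rightarrow> ('a + (nat \<Rightarrow> 'a) set) topology" where
  "edge_topology V E = topology_generated_by (edge_base V E)"

lemma ray_lies_in_dichotomy:
  assumes x: "x \<in> rays V E" and fin: "finite (edge_boundary V E e)"
  shows "ray_lies_in x e \<or> ray_lies_in x (V - e)"
proof -
  have inj: "inj x" and V: "\<And>n. x n \<in> V" and E: "\<And>n. {x n, x (Suc n)} \<in> E"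
    using x by (auto simp: rays_def)
  define f where "f n = {x n, x (Suc n)}" for n
  have "inj f"
  proof (rule injI)
    fix m n assume "f m = f n"
    then show "m = n"
      by (auto simp: f_def doubleton_eq_iff inj_eq[OF inj])
  qed
  then have "finite (f -` edge_boundary V E e)"
    using fin by (intro finite_vimageI)
  then obtain N where N: "\<And>n. f n \<in> edge_boundary V E e \<Longrightarrow> n < N"
    by (metis finite_nat_set_iff_bounded vimageI2)
  have step: "x (Suc n) \<in> e \<longleftrightarrow> x n \<in> e" if "n \<ge> N" for n
  proof -
    have "f n \<notin> edge_boundary V E e" using N that by (meson not_le)
    then show ?thesis
      using E[of n] V[of n] V[of "Suc n"] unfolding edge_boundary_def f_def
      by (smt (verit) Diff_iff insert_commute mem_Collect_eq)
  qed
  have const: "x n \<in> e \<longleftrightarrow> x N \<in> e" if "n \<ge> N" for n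
    using that by (induction n rule: dec_induct) (simp_all add: step)
  have tail: "ray_lies_in x A" if "\<And>n. n \<ge> N \<Longrightarrow> x n \<in> A" for A
  proof -
    have "range x - A \<subseteq> x ` {..<N}" using that by (force simp: not_less[symmetric])
    then show ?thesis unfolding ray_lies_in_def by (rule finite_subset) simp
  qed
  show ?thesis
    using const V by (cases "x N \<in> e") (auto intro!: tail)
qed

lemma not_ray_lies_in_both:
  assumes "x \<in> rays V E" "ray_lies_in x e" "ray_lies_in x (V - e)"
  shows False
proof -
  have "range x \<subseteq> (range x - e) \<union> (range x - (V - e))" by blast
  then have "finite (range x)"
    using assms(2,3) unfolding ray_lies_in_def by (meson finite_UnI finite_subset)
  moreover have "inj x" using assms(1) by (simp add: rays_def)
  ultimately show False using range_inj_infinite by blast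
qed

lemma equiv_edge_equivalence: "equiv (rays V E) (edge_equivalence V E)"
proof (rule equivI)
  show "edge_equivalence V E \<subseteq> rays V E \<times> rays V E"
    by (auto simp: edge_equivalence_def)
  show "refl_on (rays V E) (edge_equivalence V E)"
    by (rule refl_onI) (auto simp: edge_equivalence_def separates_def dest: not_ray_lies_in_both)
  show "sym (edge_equivalence V E)"
    by (rule symI) (auto simp: edge_equivalence_def separates_def)
  show "trans (edge_equivalence V E)"
  proof (rule transI)
    fix x y z assume xy: "(x, y) \<in> edge_equivalence V E" and yz: "(y, z) \<in> edge_equivalence V E"
    have "\<not> separates V e x z" if "edge_cut V E e" for e
      using xy yz ray_lies_in_dichotomy[of y V E e] that
      by (auto simp: edge_equivalence_def separates_def edge_cut_def)
    then show "(x, z) \<in> edge_equivalence V E"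
      using xy yz by (auto simp: edge_equivalence_def)
  qed
qed

lemma edge_ends_in_vertex_set: "edge_ends_in V E V = edge_ends V E"
proof -
  have "ray_lies_in x V" if "\<omega> \<in> edge_ends V E" "x \<in> \<omega>" for \<omega> x
  proof -
    have "x \<in> rays V E"
      using that by (auto simp: edge_ends_def quotient_def edge_equivalence_def)
    then have "range x - V = {}" by (auto simp: rays_def)
    then show ?thesis by (metis ray_lies_in_def finite.emptyI)
  qed
  then show ?thesis by (auto simp: edge_ends_in_def)
qed

lemma topspace_edge_topology: "topspace (edge_topology V E) = Inl ` V \<union> Inr ` edge_ends V E"
proof -
  have "edge_boundary V E V = {}" by (auto simp: edge_boundary_def)
  then have "Inl ` V \<union> Inr ` edge_ends V E \<in> edge_base V E"
    unfolding edge_base_def using edge_ends_in_vertex_set[of V E] by (force intro!: exI[of _ V])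
  moreover have "b \<subseteq> Inl ` V \<union> Inr ` edge_ends V E" if "b \<in> edge_base V E" for b
    using that by (auto simp: edge_base_def edge_ends_in_def)
  ultimately show ?thesis
    unfolding edge_topology_def topology_generated_by_topspace by blast
qed

lemma edge_base_Int:
  assumes "a \<in> edge_base V E" "b \<in> edge_base V E"
  shows "a \<inter> b \<in> edge_base V E"
proof -
  obtain e f where e: "e \<subseteq> V" "finite (edge_boundary V E e)" "a = Inl ` e \<union> Inr ` edge_ends_in V E e"
    and f: "f \<subseteq> V" "finite (edge_boundary V E f)" "b = Inl ` f \<union> Inr ` edge_ends_in V E f"
    using assms by (auto simp: edge_base_def)
  have "edge_boundary V E (e \<inter> f) \<subseteq> edge_boundary V E e \<union> edge_boundary V E f"
    by (auto simp: edge_boundary_def)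
  then have "finite (edge_boundary V E (e \<inter> f))"
    using e(2) f(2) by (meson finite_UnI finite_subset)
  moreover have "edge_ends_in V E (e \<inter> f) = edge_ends_in V E e \<inter> edge_ends_in V E f"
    by (auto simp: edge_ends_in_def ray_lies_in_def Diff_Int)
  then have "a \<inter> b = Inl ` (e \<inter> f) \<union> Inr ` edge_ends_in V E (e \<inter> f)"
    using e(3) f(3) by auto
  ultimately show ?thesis
    unfolding edge_base_def using e(1) by blast
qed

lemma openin_edge_topology:
  "openin (edge_topology V E) U \<longleftrightarrow> (\<exists>\<B> \<subseteq> edge_base V E. U = \<Union>\<B>)"
proof
  assume "openin (edge_topology V E) U"
  then have "generate_topology_on (edge_base V E) U"
    by (simp add: edge_topology_def openin_topology_generated_by_iff)
  then show "\<exists>\<B> \<subseteq> edge_base V E. U = \<Union>\<B>"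
  proof induction
    case Empty
    then show ?case by (intro exI[of _ "{}"]) simp
  next
    case (Int a b)
    then obtain A B where "A \<subseteq> edge_base V E" "a = \<Union>A" "B \<subseteq> edge_base V E" "b = \<Union>B" by blast
    then show ?case
      by (intro exI[of _ "{s \<inter> t | s t. s \<in> A \<and> t \<in> B}"]) (auto intro!: edge_base_Int)
  next
    case (UN K)
    then obtain F where F: "\<And>k. k \<in> K \<Longrightarrow> F k \<subseteq> edge_base V E \<and> k = \<Union>(F k)" by metis
    have "\<Union>K = \<Union>(\<Union>(F ` K))"
    proof (intro equalityI subsetI)
      fix x assume "x \<in> \<Union>K"
      then obtain k where "k \<in> K" "x \<in> k" by blast
      moreover have "x \<in> \<Union>(F k)" using F \<open>k \<in> K\<close> \<open>x \<in> k\<close> by simp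
      ultimately show "x \<in> \<Union>(\<Union>(F ` K))" by blast
    next
      fix x assume "x \<in> \<Union>(\<Union>(F ` K))"
      then obtain k where "k \<in> K" "x \<in> \<Union>(F k)" by blast
      moreover have "x \<in> k" using F[of k] \<open>k \<in> K\<close> \<open>x \<in> \<Union>(F k)\<close> by simp
      ultimately show "x \<in> \<Union>K" by blast
    qed
    moreover have "\<Union>(F ` K) \<subseteq> edge_base V E" using F by blast
    ultimately show ?case by blast
  next
    case (Basis s)
    then show ?case by (intro exI[of _ "{s}"]) simp
  qed
next
  assume "\<exists>\<B> \<subseteq> edge_base V E. U = \<Union>\<B>"
  then show "openin (edge_topology V E) U"
    unfolding edge_topology_def by (blast intro: openin_Union topology_generated_by_Basis)
qed

end

theory Submission
  imports Defs
begin

text \<open>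
  Call a vertex set with finite edge-boundary bad if no finite subfamily of the given cover covers
  it. If \<open>V\<close> is bad, one finds bad connected sets \<open>e\<^sub>0 \<supseteq> e\<^sub>1 \<supseteq> \<dots>\<close>, where \<open>e\<^sub>n\<^sub>+\<^sub>1\<close> avoids all endpoints of
  the boundary edges of \<open>e\<^sub>n\<close>: removing the finitely many members of the cover that contain these
  endpoints preserves badness, and by connectedness of the graph what remains has only finitely
  many components. A path of length \<open>k\<close> that starts outside \<open>e\<^sub>0\<close> cannot enter \<open>e\<^sub>k\<close>, so the \<open>e\<^sub>n\<close> have
  empty intersection and there is a ray which is eventually inside each of them. The end of this
  ray lies in some member \<open>f\<close> of the cover. For large \<open>n\<close> the set \<open>e\<^sub>n\<close> contains no endpoint of
  \<open>\<delta>f\<close>, so \<open>e\<^sub>n\<close>, being connected, is contained in \<open>f\<close>, contradicting badness.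
\<close>

section \<open>Adjacency and finite covers of vertex sets\<close>

abbreviation adjacent :: "'a set set \<Rightarrow> ('a \<times> 'a) set" where
  "adjacent E \<equiv> {(u, v). {u, v} \<in> E}"

text \<open>Only vertices are counted here; \<open>edge_end_in_member_of_finite_cover\<close> shows
  that the ends then follow.\<close>

definition finitely_covered :: "'a set set \<Rightarrow> 'a set \<Rightarrow> bool" where
  "finitely_covered \<F> e \<longleftrightarrow> (\<exists>\<G>\<subseteq>\<F>. finite \<G> \<and> e \<subseteq> \<Union>\<G>)"

lemma finitely_covered_mono: "finitely_covered \<F> e \<Longrightarrow> d \<subseteq> e \<Longrightarrow> finitely_covered \<F> d"
  unfolding finitely_covered_def by blast

lemma finitely_covered_member: "f \<in> \<F> \<Longrightarrow> finitely_covered \<F> f"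
  unfolding finitely_covered_def by (intro exI[of _ "{f}"]) simp

lemma finitely_covered_Union:
  assumes "finite \<A>" "\<And>a. a \<in> \<A> \<Longrightarrow> finitely_covered \<F> a"
  shows "finitely_covered \<F> (\<Union>\<A>)"
proof -
  obtain G where G: "\<And>a. a \<in> \<A> \<Longrightarrow> G a \<subseteq> \<F> \<and> finite (G a) \<and> a \<subseteq> \<Union>(G a)"
    using assms(2) unfolding finitely_covered_def by metis
  have "\<Union>(G ` \<A>) \<subseteq> \<F>" "finite (\<Union>(G ` \<A>))"
    using G assms(1) by auto
  moreover have "\<Union>\<A> \<subseteq> \<Union>(\<Union>(G ` \<A>))"
    using G by fastforce
  ultimately show ?thesis unfolding finitely_covered_def by blast
qed

section \<open>Edge-boundaries and components of induced subgraphs\<close>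

lemma edge_boundaryI:
  "{x, y} \<in> E \<Longrightarrow> x \<in> e \<Longrightarrow> y \<in> V \<Longrightarrow> y \<notin> e \<Longrightarrow> {x, y} \<in> edge_boundary V E e"
  by (auto simp: edge_boundary_def)

lemma finite_Union_edge_boundary:
  "finite (edge_boundary V E e) \<Longrightarrow> finite (\<Union>(edge_boundary V E e))"
  by (rule finite_Union) (auto simp: edge_boundary_def)

lemma simple_graph_edgeD: "simple_graph V E \<Longrightarrow> {x, y} \<in> E \<Longrightarrow> x \<in> V \<and> y \<in> V"
  unfolding simple_graph_def by (fastforce simp: doubleton_eq_iff)

lemma finite_edge_boundary_Diff:
  assumes "finite (edge_boundary V E e)" "finite (edge_boundary V E f)" "e \<subseteq> V"
  shows "finite (edge_boundary V E (e - f))"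
proof (rule finite_subset)
  show "edge_boundary V E (e - f) \<subseteq> edge_boundary V E e \<union> edge_boundary V E f"
  proof
    fix d assume "d \<in> edge_boundary V E (e - f)"
    then obtain x y where d: "d \<in> E" "d = {x, y}" "x \<in> e" "x \<notin> f" "y \<in> V" "y \<notin> e \<or> y \<in> f"
      by (auto simp: edge_boundary_def)
    show "d \<in> edge_boundary V E e \<union> edge_boundary V E f"
      using d assms(3) edge_boundaryI[of x y E e V] edge_boundaryI[of y x E f V]
      by (auto simp: insert_commute)
  qed
qed (use assms in simp)

text \<open>Along a walk inside \<open>e\<close> membership in \<open>f\<close> cannot be lost: the
  edge losing it would be in the boundary of \<open>f\<close> and have an endpoint in
  \<open>e\<close>.\<close>

lemma connected_subset_if_avoids_boundary:
  assumes "connected_graph e (E \<inter> Pow e)" "e \<subseteq> V" "e \<inter> \<Union>(edge_boundary V E f) = {}"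
    and "v \<in> e" "v \<in> f"
  shows "e \<subseteq> f"
proof
  fix w assume "w \<in> e"
  with assms(1,4) have "(v, w) \<in> (adjacent (E \<inter> Pow e))\<^sup>*"
    by (simp add: connected_graph_def)
  then show "w \<in> f"
  proof induction
    case base
    show ?case by fact
  next
    case (step y z)
    then have "{y, z} \<in> E" "y \<in> e" "z \<in> e" by auto
    with step.IH assms(2,3) edge_boundaryI[of y z E f V] show ?case by blast
  qed
qed

text \<open>An edge from \<open>C\<close> to another vertex of \<open>e\<close> would extend the
  component, so every boundary edge of \<open>C\<close> leaves \<open>e\<close>.\<close>

lemma edge_boundary_component:
  assumes "C = (adjacent (E \<inter> Pow e))\<^sup>* `` {v}" "v \<in> e"
  shows "C \<subseteq> e" "edge_boundary V E C \<subseteq> edge_boundary V E e" "connected_graph C (E \<inter> Pow C)"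
proof -
  let ?R = "adjacent (E \<inter> Pow e)" and ?S = "adjacent (E \<inter> Pow C)"
  have "w \<in> e" if "(v, w) \<in> ?R\<^sup>*" for w
    using that assms(2) by induction auto
  then show sub: "C \<subseteq> e" using assms(1) by blast
  show "edge_boundary V E C \<subseteq> edge_boundary V E e"
  proof
    fix d assume "d \<in> edge_boundary V E C"
    then obtain x y where d: "d \<in> E" "d = {x, y}" "x \<in> C" "y \<in> V" "y \<notin> C"
      by (auto simp: edge_boundary_def)
    have "y \<notin> e"
    proof
      assume "y \<in> e"
      with d sub have "(x, y) \<in> ?R" by auto
      with d(3) assms(1) have "y \<in> C" by (auto intro: rtrancl_into_rtrancl)
      with d show False by simp
    qed
    with d sub show "d \<in> edge_boundary V E e" using edge_boundaryI[of x y E e V] by auto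
  qed
  \<comment> \<open>Every vertex on a walk from \<open>v\<close> inside \<open>e\<close> is itself
    reachable, so the walk stays in \<open>C\<close>.\<close>
  have reach: "(v, w) \<in> ?S\<^sup>*" if "(v, w) \<in> ?R\<^sup>*" for w
    using that
  proof induction
    case base
    show ?case by simp
  next
    case (step y z)
    from step.hyps have "y \<in> C" "z \<in> C"
      using assms(1) by (auto intro: rtrancl_into_rtrancl)
    with step have "(y, z) \<in> ?S" by auto
    with step.IH show ?case by (rule rtrancl_into_rtrancl)
  qed
  have "sym ?S" by (auto simp: sym_def insert_commute)
  then have sym: "sym (?S\<^sup>*)" by (rule sym_rtrancl)
  show "connected_graph C (E \<inter> Pow C)"
    unfolding connected_graph_def
  proof (intro ballI)
    fix y z assume "y \<in> C" "z \<in> C"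
    then have "(v, y) \<in> ?S\<^sup>*" "(v, z) \<in> ?S\<^sup>*" using reach assms(1) by blast+
    then show "(y, z) \<in> ?S\<^sup>*" using symD[OF sym] by (blast intro: rtrancl_trans)
  qed
qed

text \<open>The vertex at which a walk from \<open>c\<close> to \<open>v\<close> enters
  \<open>e\<close> for the last time is an endpoint of a boundary edge. Hence a finite boundary
  leaves only finitely many components.\<close>

lemma component_meets_boundary:
  assumes "simple_graph V E" "connected_graph V E" "e \<subseteq> V" "c \<in> V" "c \<notin> e" "v \<in> e"
  shows "\<exists>u \<in> e \<inter> \<Union>(edge_boundary V E e). (u, v) \<in> (adjacent (E \<inter> Pow e))\<^sup>*"
proof -
  have "(c, v) \<in> (adjacent E)\<^sup>*"
    using assms unfolding connected_graph_def by blast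
  then show ?thesis using \<open>v \<in> e\<close>
  proof induction
    case base
    then show ?case using assms(5) by simp
  next
    case (step y z)
    then have yz: "{y, z} \<in> E" by simp
    show ?case
    proof (cases "y \<in> e")
      case True
      with yz step.prems have "(y, z) \<in> adjacent (E \<inter> Pow e)" by simp
      with step.IH[OF True] show ?thesis by (meson rtrancl_into_rtrancl)
    next
      case False
      have "{z, y} \<in> edge_boundary V E e"
        using yz False step.prems simple_graph_edgeD[OF assms(1) yz]
        by (intro edge_boundaryI) (auto simp: insert_commute)
      with step.prems show ?thesis by blast
    qed
  qed
qed

section \<open>Shrinking a set that is not finitely covered\<close>

lemma not_finitely_covered_connected_subset:
  assumes G: "simple_graph V E" "connected_graph V E"
    and fin: "\<And>f. f \<in> \<F> \<Longrightarrow> finite (edge_boundary V E f)" and cover: "V \<subseteq> \<Union>\<F>"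
    and e: "e \<subseteq> V" "finite (edge_boundary V E e)" "\<not> finitely_covered \<F> e"
    and S: "finite S" "S \<subseteq> V" "S \<noteq> {}"
  shows "\<exists>d\<subseteq>e. finite (edge_boundary V E d) \<and> \<not> finitely_covered \<F> d \<and> d \<inter> S = {} \<and>
    connected_graph d (E \<inter> Pow d)"
proof -
  have "\<exists>d\<subseteq>e. finite (edge_boundary V E d) \<and> \<not> finitely_covered \<F> d \<and> d \<inter> S = {}"
    using S(1,2)
  proof (induction S rule: finite_induct)
    case empty
    show ?case using e by blast
  next
    case (insert s S)
    then obtain d where d: "d \<subseteq> e" "finite (edge_boundary V E d)" "\<not> finitely_covered \<F> d"
      "d \<inter> S = {}" by auto
    obtain f where f: "f \<in> \<F>" "s \<in> f" using insert.prems cover by blast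
    \<comment> \<open>Deleting one member of the cover discards a finitely covered part, so the rest
      stays bad.\<close>
    have "\<not> finitely_covered \<F> (d - f)"
    proof
      assume "finitely_covered \<F> (d - f)"
      with f have "finitely_covered \<F> (\<Union>{d - f, f})"
        by (intro finitely_covered_Union) (auto intro: finitely_covered_member)
      then have "finitely_covered \<F> d" by (rule finitely_covered_mono) auto
      with d show False by simp
    qed
    moreover have "finite (edge_boundary V E (d - f))"
      using d e(1) fin[OF f(1)] by (intro finite_edge_boundary_Diff) auto
    ultimately show ?case using d f by (intro exI[of _ "d - f"]) auto
  qed
  then obtain d where d: "d \<subseteq> e" "finite (edge_boundary V E d)" "\<not> finitely_covered \<F> d"
    "d \<inter> S = {}" by blast
  \<comment> \<open>Here \<open>S \<noteq> {}\<close> provides a vertex outside \<open>d\<close>,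
    from which walks enter the components of \<open>d\<close>.\<close>
  obtain c where c: "c \<in> V" "c \<notin> d" using S d by blast
  define K where "K u = (adjacent (E \<inter> Pow d))\<^sup>* `` {u}" for u
  define B where "B = d \<inter> \<Union>(edge_boundary V E d)"
  have "finite B" using finite_Union_edge_boundary[OF d(2)] by (simp add: B_def)
  moreover have "d \<subseteq> \<Union>(K ` B)"
    using component_meets_boundary[OF G _ c] d(1) e(1) by (fastforce simp: K_def B_def)
  ultimately obtain u where u: "u \<in> B" "\<not> finitely_covered \<F> (K u)"
    using finitely_covered_Union[of "K ` B" \<F>] d(3) finitely_covered_mono by blast
  then have "u \<in> d" by (simp add: B_def)
  note K = edge_boundary_component[OF K_def this]
  have "finite (edge_boundary V E (K u))" using K(2) d(2) by (rule finite_subset)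
  then show ?thesis using K(1,3) u(2) d by (intro exI[of _ "K u"]) blast
qed

section \<open>Construction of a ray\<close>

lemma ray_through_decreasing_connected_sets:
  fixes e :: "nat \<Rightarrow> 'a set"
  assumes sub: "e 0 \<subseteq> V" and dec: "decseq e" and ne: "\<And>n. e n \<noteq> {}" and empty: "(\<Inter>n. e n) = {}"
    and conn: "\<And>n. connected_graph (e n) (E \<inter> Pow (e n))"
  shows "\<exists>x\<in>rays V E. \<forall>n. ray_lies_in x (e n)"
proof -
  \<comment> \<open>\<open>r v\<close> is the last index with \<open>v \<in> e (r v)\<close>, and \<open>h v\<close> the distance from \<open>v\<close> to the next set inside
    \<open>e (r v)\<close>. A walk that increases \<open>r\<close>, or keeps \<open>r\<close> and decreases \<open>h\<close>, never repeats a vertex.\<close>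
  define r where "r v = (LEAST n. v \<notin> e (Suc n))" for v
  define D where "D v m \<longleftrightarrow> (\<exists>u\<in>e (Suc (r v)). (v, u) \<in> (adjacent (E \<inter> Pow (e (r v)))) ^^ m)" for v m
  define h where "h v = (LEAST m. D v m)" for v
  have mono: "e n \<subseteq> e m" if "m \<le> n" for m n
    using dec that by (simp add: decseq_def)
  \<comment> \<open>The empty intersection makes the least index exist. Because of the shift to
    \<open>Suc n\<close>, the case \<open>r v = 0\<close> rests on
    \<open>v \<in> e 0\<close>.\<close>
  have r: "v \<in> e n \<longleftrightarrow> n \<le> r v" if "v \<in> e 0" for v n
  proof -
    obtain k where "v \<notin> e k" using empty by blast
    then have "v \<notin> e (Suc k)" using mono[of k "Suc k"] by auto
    then have 1: "v \<notin> e (Suc (r v))" unfolding r_def by (rule LeastI)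
    have 2: "v \<in> e (r v)"
    proof (cases "r v")
      case (Suc m)
      then show ?thesis using not_less_Least[of m "\<lambda>n. v \<notin> e (Suc n)"] by (simp add: r_def)
    qed (use that in simp)
    show ?thesis
      using 1 2 mono[of n "r v"] mono[of "Suc (r v)" n] by (cases "n \<le> r v") auto
  qed
  have step: "\<exists>w\<in>e 0. {v, w} \<in> E \<and> (r v < r w \<or> r w = r v \<and> h w < h v)" if v: "v \<in> e 0" for v
  proof -
    let ?R = "adjacent (E \<inter> Pow (e (r v)))"
    obtain u where u: "u \<in> e (Suc (r v))" using ne by blast
    have "v \<in> e (r v)" using r[OF v] by simp
    moreover have "u \<in> e (r v)" using u mono[of "r v" "Suc (r v)"] by auto
    ultimately have "(v, u) \<in> ?R\<^sup>*" using conn[of "r v"] by (simp add: connected_graph_def)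
    then have "\<exists>m. D v m" using u unfolding D_def by (metis rtrancl_imp_relpow)
    then have "D v (h v)" unfolding h_def by (rule LeastI_ex)
    then obtain u' where u': "u' \<in> e (Suc (r v))" "(v, u') \<in> ?R ^^ h v" unfolding D_def by blast
    \<comment> \<open>A shortest path to the next set has a first edge. Its head \<open>w\<close>
      lies deeper than \<open>v\<close>, or the rest of the path shows that \<open>w\<close> is
      closer to the next set.\<close>
    have "v \<notin> e (Suc (r v))" using r[OF v] by simp
    with u' have "h v \<noteq> 0" by (metis relpow_0_E)
    then obtain m where m: "h v = Suc m" using not0_implies_Suc by blast
    then obtain w where w: "(v, w) \<in> ?R" "(w, u') \<in> ?R ^^ m" using u'(2) by (metis relpow_Suc_D2)
    then have w_mem: "w \<in> e (r v)" and vw: "{v, w} \<in> E" by auto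
    then have w0: "w \<in> e 0" using mono[of 0 "r v"] by auto
    have "h w < h v" if "r w = r v"
    proof -
      have "D w m" unfolding D_def that using u'(1) w(2) by blast
      then show ?thesis unfolding h_def[of w] m by (meson Least_le le_imp_less_Suc)
    qed
    moreover have "r v \<le> r w" using r[OF w0] w_mem by simp
    ultimately show ?thesis using w0 vw by (intro bexI[of _ w]) auto
  qed
  obtain s where s: "\<And>v. v \<in> e 0 \<Longrightarrow> s v \<in> e 0 \<and> {v, s v} \<in> E \<and>
      (r v < r (s v) \<or> r (s v) = r v \<and> h (s v) < h v)"
    using step by metis
  obtain c where c: "c \<in> e 0" using ne by blast
  define x where "x n = (s ^^ n) c" for n
  have x0: "x n \<in> e 0" for n by (induction n) (auto simp: x_def c s)
  have xs: "{x n, x (Suc n)} \<in> E"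
    "r (x n) < r (x (Suc n)) \<or> r (x (Suc n)) = r (x n) \<and> h (x (Suc n)) < h (x n)" for n
    using s[OF x0[of n]] by (auto simp: x_def)
  have less: "r (x m) < r (x n) \<or> r (x n) = r (x m) \<and> h (x n) < h (x m)" if "m < n" for m n
    using that
  proof (induction n rule: less_Suc_induct)
    case (1 i)
    show ?case by (rule xs(2))
  next
    case (2 i j k)
    then show ?case by linarith
  qed
  have "inj x"
  proof (rule linorder_injI)
    show "x m \<noteq> x n" if "m < n" for m n using less[OF that] by auto
  qed
  moreover have "range x \<subseteq> V" using x0 sub by auto
  ultimately have ray: "x \<in> rays V E" using xs(1) by (simp add: rays_def)
  \<comment> \<open>While \<open>r\<close> stalls, \<open>h\<close> strictly decreases, which cannot
    go on forever.\<close>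
  have grow: "\<exists>m. r (x k) < r (x m)" for k
  proof (induction "h (x k)" arbitrary: k rule: less_induct)
    case less
    show ?case
    proof (cases "r (x k) < r (x (Suc k))")
      case False
      with xs(2)[of k] have "r (x (Suc k)) = r (x k)" "h (x (Suc k)) < h (x k)" by auto
      with less show ?thesis by metis
    qed blast
  qed
  have "ray_lies_in x (e n)" for n
  proof -
    have "\<exists>k. n \<le> r (x k)"
    proof (induction n)
      case (Suc n)
      then show ?case using grow by (meson Suc_leI le_less_trans)
    qed simp
    then obtain k where k: "n \<le> r (x k)" by blast
    have "x m \<in> e n" if "k \<le> m" for m
      using r[OF x0[of m], of n] k less[of k m] that by (cases "k = m") auto
    then have "range x - e n \<subseteq> x ` {..<k}" by (force simp: not_less[symmetric])
    then show ?thesis unfolding ray_lies_in_def by (rule finite_subset) simp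
  qed
  with ray show ?thesis by blast
qed

section \<open>A ray that escapes every member of the cover\<close>

lemma ray_in_no_member_of_cover:
  assumes G: "simple_graph V E" "connected_graph V E"
    and fin: "\<And>f. f \<in> \<F> \<Longrightarrow> finite (edge_boundary V E f)" and cover: "V \<subseteq> \<Union>\<F>"
    and V: "\<not> finitely_covered \<F> V"
  shows "\<exists>x\<in>rays V E. \<forall>f\<in>\<F>. \<not> ray_lies_in x f"
proof -
  define P where "P d \<longleftrightarrow> d \<subseteq> V \<and> finite (edge_boundary V E d) \<and> \<not> finitely_covered \<F> d \<and>
    connected_graph d (E \<inter> Pow d)" for d
  have "V \<noteq> {}" using V by (auto simp: finitely_covered_def)
  then obtain c where c: "c \<in> V" by blast
  have "edge_boundary V E V = {}" by (auto simp: edge_boundary_def)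
  then obtain e0 where e0: "P e0" "c \<notin> e0"
    using not_finitely_covered_connected_subset[OF G fin cover, of V "{c}"] V c
    by (auto simp: P_def)
  have "\<exists>d. P d \<and> d \<subseteq> e \<and> d \<inter> \<Union>(edge_boundary V E e) = {}" if "P e" for e
  proof -
    \<comment> \<open>Inserting \<open>c\<close> makes the set to be avoided nonempty, whatever the
      boundary is.\<close>
    have "insert c (\<Union>(edge_boundary V E e)) \<subseteq> V"
      using c that by (auto simp: edge_boundary_def P_def)
    then show ?thesis
      using not_finitely_covered_connected_subset
          [OF G fin cover, of e "insert c (\<Union>(edge_boundary V E e))"] that
        finite_Union_edge_boundary[of V E e]
      unfolding P_def by blast
  qed
  then obtain t where t: "\<And>e. P e \<Longrightarrow> P (t e) \<and> t e \<subseteq> e \<and> t e \<inter> \<Union>(edge_boundary V E e) = {}"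
    by metis
  define e where "e n = (t ^^ n) e0" for n
  have Pe: "P (e n)" for n by (induction n) (auto simp: e_def e0 t)
  have dec: "decseq e" using t[OF Pe] by (intro decseq_SucI) (simp add: e_def)
  have avoid: "e (Suc n) \<inter> \<Union>(edge_boundary V E (e n)) = {}" for n
    using t[OF Pe[of n]] by (simp add: e_def)
  \<comment> \<open>Induction along a walk from \<open>c\<close>: each edge costs at most one index,
    as a neighbour of a vertex outside \<open>e n\<close> is either outside \<open>e n\<close> too
    or an endpoint avoided by \<open>e (Suc n)\<close>.\<close>
  have leave: "\<exists>n. v \<notin> e n" if "v \<in> V" for v
  proof -
    have "(c, v) \<in> (adjacent E)\<^sup>*" using G(2) c that by (simp add: connected_graph_def)
    then show ?thesis
    proof induction
      case base
      then show ?case using e0(2) by (intro exI[of _ 0]) (simp add: e_def)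
    next
      case (step y z)
      then obtain n where "y \<notin> e n" by blast
      moreover have "{z, y} \<in> E" using step.hyps by (simp add: insert_commute)
      moreover have "y \<in> V" using simple_graph_edgeD[OF G(1) \<open>{z, y} \<in> E\<close>] by simp
      ultimately have "z \<in> e n \<Longrightarrow> z \<notin> e (Suc n)"
        using edge_boundaryI[of z y E "e n" V] avoid[of n] by blast
      then show ?case by blast
    qed
  qed
  have eV: "e n \<subseteq> V" for n using Pe[of n] by (simp add: P_def)
  have "(\<Inter>n. e n) = {}" using leave eV by blast
  moreover have "e n \<noteq> {}" for n using Pe[of n] by (auto simp: P_def finitely_covered_def)
  ultimately obtain x where x: "x \<in> rays V E" "\<And>n. ray_lies_in x (e n)"
    using ray_through_decreasing_connected_sets[of e V E] dec eV Pe unfolding P_def by blast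
  have "\<not> ray_lies_in x f" if f: "f \<in> \<F>" for f
  proof
    assume "ray_lies_in x f"
    define S where "S = \<Union>(edge_boundary V E f)"
    have "finite S" using fin[OF f] by (simp add: S_def finite_Union_edge_boundary)
    then have "\<exists>n. e n \<inter> S = {}"
    proof (induction S rule: finite_induct)
      case (insert s S)
      then obtain n where n: "e n \<inter> S = {}" by blast
      obtain k where k: "s \<notin> e k" using leave eV by blast
      have "e (max n k) \<subseteq> e n \<inter> e k" using decseqD[OF dec] by simp
      with n k show ?case by (intro exI[of _ "max n k"]) blast
    qed simp
    then obtain n where n: "e n \<inter> \<Union>(edge_boundary V E f) = {}" unfolding S_def by blast
    \<comment> \<open>All but finitely many vertices of the ray lie in both \<open>e n\<close> and
      \<open>f\<close>, so these sets meet.\<close>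
    have "infinite (range x)" using x(1) by (simp add: rays_def range_inj_infinite)
    moreover have "finite ((range x - e n) \<union> (range x - f))"
      using x(2)[of n] \<open>ray_lies_in x f\<close> by (simp add: ray_lies_in_def)
    ultimately have "\<not> range x \<subseteq> (range x - e n) \<union> (range x - f)"
      using finite_subset by blast
    then obtain v where "v \<in> e n" "v \<in> f" by blast
    then have "e n \<subseteq> f"
      using connected_subset_if_avoids_boundary[of "e n" E V f v] Pe[of n] n by (simp add: P_def)
    then show False
      using Pe[of n] finitely_covered_mono[OF finitely_covered_member[OF f]] by (simp add: P_def)
  qed
  with x(1) show ?thesis by blast
qed

section \<open>From vertices to edge-ends, and compactness\<close>

text \<open>A ray lying in all the complements would have finitely many vertices, so by the
  dichotomy it lies in some member. This member is an edge-cut, so equivalent rays lie in it as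
  well.\<close>

lemma edge_end_in_member_of_finite_cover:
  assumes "finite \<G>" "V \<subseteq> \<Union>\<G>" "\<And>f. f \<in> \<G> \<Longrightarrow> f \<subseteq> V \<and> finite (edge_boundary V E f)"
    and \<omega>: "\<omega> \<in> edge_ends V E"
  shows "\<exists>f\<in>\<G>. \<omega> \<in> edge_ends_in V E f"
proof -
  obtain x where x: "x \<in> rays V E" "\<omega> = edge_equivalence V E `` {x}"
    using \<omega> by (auto simp: edge_ends_def quotient_def)
  have "\<exists>f\<in>\<G>. ray_lies_in x f"
  proof (rule ccontr)
    assume "\<not> ?thesis"
    then have "ray_lies_in x (V - f)" if "f \<in> \<G>" for f
      using ray_lies_in_dichotomy[OF x(1)] assms(3) that by blast
    then have "finite (\<Union>f\<in>\<G>. range x - (V - f))"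
      using assms(1) by (intro finite_UN_I) (simp_all add: ray_lies_in_def)
    moreover have "range x \<subseteq> (\<Union>f\<in>\<G>. range x - (V - f))"
      using x(1) assms(2) by (auto simp: rays_def)
    ultimately have "finite (range x)" by (rule rev_finite_subset)
    then show False using x(1) by (simp add: rays_def range_inj_infinite)
  qed
  then obtain f where f: "f \<in> \<G>" "ray_lies_in x f" by blast
  have "f \<noteq> {}" using f(2) x(1) by (auto simp: ray_lies_in_def rays_def range_inj_infinite)
  then have cut: "edge_cut V E f" using assms(3)[OF f(1)] by (simp add: edge_cut_def)
  have "ray_lies_in y f" if "y \<in> \<omega>" for y
    using that x(2) f(2) cut ray_lies_in_dichotomy[of y V E f]
    by (auto simp: edge_equivalence_def separates_def edge_cut_def)
  with f(1) \<omega> show ?thesis by (auto simp: edge_ends_in_def)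
qed

theorem theorem2:
  fixes V :: "'a set" and E :: "'a set set"
  assumes "simple_graph V E" and "connected_graph V E"
  shows "compact_space (edge_topology V E)"
proof -
  let ?X = "edge_topology V E"
  define b where "b e = Inl ` e \<union> Inr ` edge_ends_in V E e" for e
  have "\<exists>\<V>. finite \<V> \<and> \<V> \<subseteq> \<U> \<and> topspace ?X \<subseteq> \<Union>\<V>"
    if \<U>: "\<And>U. U \<in> \<U> \<Longrightarrow> openin ?X U" "topspace ?X \<subseteq> \<Union>\<U>" for \<U>
  proof -
    \<comment> \<open>The open cover is refined to base sets, recorded by their vertex
      parts.\<close>
    define \<F> where "\<F> = {e. e \<subseteq> V \<and> finite (edge_boundary V E e) \<and> (\<exists>U\<in>\<U>. b e \<subseteq> U)}"
    have refine: "\<exists>e\<in>\<F>. z \<in> b e" if z: "z \<in> topspace ?X" for z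
    proof -
      obtain U where U: "U \<in> \<U>" "z \<in> U" using z \<U>(2) by blast
      then obtain \<B> where \<B>: "\<B> \<subseteq> edge_base V E" "U = \<Union>\<B>"
        using \<U>(1) by (auto simp: openin_edge_topology)
      then obtain B where "B \<in> \<B>" "z \<in> B" "B \<subseteq> U" using U(2) by blast
      moreover then obtain e where "e \<subseteq> V" "finite (edge_boundary V E e)" "B = b e"
        using \<B>(1) by (auto simp: edge_base_def b_def)
      ultimately show ?thesis using U(1) by (auto simp: \<F>_def)
    qed
    have "V \<subseteq> \<Union>\<F>"
    proof
      fix v assume "v \<in> V"
      then show "v \<in> \<Union>\<F>" using refine[of "Inl v"] by (auto simp: topspace_edge_topology b_def)
    qed
    have "finitely_covered \<F> V"
    proof (rule ccontr)
      assume "\<not> ?thesis"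
      then obtain x where x: "x \<in> rays V E" "\<And>f. f \<in> \<F> \<Longrightarrow> \<not> ray_lies_in x f"
        using ray_in_no_member_of_cover[OF assms _ \<open>V \<subseteq> \<Union>\<F>\<close>] by (auto simp: \<F>_def)
      \<comment> \<open>The end of the escaping ray must lie in some member of \<open>\<F>\<close>,
        and then so does the ray itself.\<close>
      let ?\<omega> = "edge_equivalence V E `` {x}"
      have "?\<omega> \<in> edge_ends V E" using x(1) by (simp add: edge_ends_def quotientI)
      then obtain e where "e \<in> \<F>" "?\<omega> \<in> edge_ends_in V E e"
        using refine[of "Inr ?\<omega>"] by (auto simp: topspace_edge_topology b_def)
      moreover have "x \<in> ?\<omega>" using equiv_edge_equivalence x(1) by (rule equiv_class_self)
      ultimately show False using x(2) by (auto simp: edge_ends_in_def)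
    qed
    then obtain \<G> where \<G>: "\<G> \<subseteq> \<F>" "finite \<G>" "V \<subseteq> \<Union>\<G>" by (auto simp: finitely_covered_def)
    have "\<exists>f. \<forall>e\<in>\<G>. f e \<in> \<U> \<and> b e \<subseteq> f e" using \<G>(1) by (intro bchoice) (auto simp: \<F>_def)
    then obtain f where f: "\<And>e. e \<in> \<G> \<Longrightarrow> f e \<in> \<U> \<and> b e \<subseteq> f e" by blast
    have "topspace ?X \<subseteq> \<Union>(b ` \<G>)"
    proof
      fix z assume "z \<in> topspace ?X"
      then consider v where "z = Inl v" "v \<in> V" | \<omega> where "z = Inr \<omega>" "\<omega> \<in> edge_ends V E"
        by (auto simp: topspace_edge_topology)
      then show "z \<in> \<Union>(b ` \<G>)"
      proof cases
        case 1
        then show ?thesis using \<G>(3) by (auto simp: b_def)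
      next
        case 2
        have "e \<subseteq> V \<and> finite (edge_boundary V E e)" if "e \<in> \<G>" for e
          using \<G>(1) that by (auto simp: \<F>_def)
        from edge_end_in_member_of_finite_cover[OF \<G>(2,3) this 2(2)] 2(1)
        show ?thesis by (auto simp: b_def)
      qed
    qed
    also have "\<dots> \<subseteq> \<Union>(f ` \<G>)" using f by blast
    finally show ?thesis using f \<G>(2) by (intro exI[of _ "f ` \<G>"]) auto
  qed
  then show ?thesis by (auto simp: compact_space_alt)
qed

end
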